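(* Let $\{w_t\},\{u_{t,k}\},\{g_{t,k}\}$ be generated by memory-based distributed SGD with momentum $\beta\in[0,1)$ and learning rates $\{\eta_t\}$ (M-DSGD, described in the context), and put $\tilde u_t=\sum_{k=1}^p u_{t,k}$, $\tilde g_t=\sum_{k=1}^p g_{t,k}$, so that $\tilde g_t=\nabla f(w_t;\mathcal{I}_t)+\beta\tilde g_{t-1}$. Set $$z_t=w_t+\rho_{t-1}\tilde g_{t-1}-\eta_t\tilde u_t,$$ where the real numbers $\rho_t$ satisfy $\beta\rho_t=\beta\eta_t+\rho_{t-1}$. Then $$z_{t+1}=z_t-(\eta_t-\rho_t)\nabla f(w_t;\mathcal{I}_t)+(\eta_t-\eta_{t+1})\tilde u_{t+1}.$$
   Context: The objective is $F(w)=\frac1n\sum_{i=1}^n f(w;\zeta_i)$, $w\in\mathbb{R}^d$, where $\zeta_1,\dots,\zeta_n$ are the training data. M-DSGD with momentum: there are $p$ workers, an initial point $w_0$, a momentum scalar $\beta\in[0,1)$, batch size $b$ and learning rates $\eta_t$. Set $g_{-1,k}=u_{0,k}=0$ for $k=1,\dots,p$. At iterations $t=0,1,2,\dots$ each worker $k$ randomly picks a mini-batch $\mathcal{I}_{t,k}$ of $b$ training samples and a vector $m_{t,k}\in\{0,1\}^d$, and with $\odot$ the coordinatewise product and $\mathbf 1=(1,\dots,1)^T$, $$g_{t,k}=\beta g_{t-1,k}+\frac{1}{pb}\sum_{\zeta_i\in\mathcal{I}_{t,k}}\nabla f(w_t;\zeta_i),\quad u_{t+1,k}=(\mathbf 1-m_{t,k})\odot(g_{t,k}+u_{t,k}),\quad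 w_{t+1}=w_t-\eta_t\sum_{k=1}^p m_{t,k}\odot(g_{t,k}+u_{t,k}).$$ The aggregated mini-batch gradient is $\nabla f(w_t;\mathcal{I}_t)=\frac{1}{pb}\sum_{k=1}^p\sum_{\zeta_i\in\mathcal{I}_{t,k}}\nabla f(w_t;\zeta_i)$. *)

theory Defs
  imports "HOL-Analysis.Analysis" "HOL-Library.Multiset"
begin

definition grad :: "(real ^ 'd \<Rightarrow> real) \<Rightarrow> real ^ 'd \<Rightarrow> real ^ 'd" where
  "grad h x = (THE D. GDERIV h x :> D)"

text \<open>
  A mini-batch is a multiset of indices of training samples, so drawing with replacement
  and drawing without replacement are both covered.
\<close>

definition batch_grad_sum ::
  "(real ^ 'd \<Rightarrow> 'z \<Rightarrow> real) \<Rightarrow> (nat \<Rightarrow> 'z) \<Rightarrow> real ^ 'd \<Rightarrow> nat multiset \<Rightarrow> real ^ 'd" where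
  "batch_grad_sum f \<zeta> x B = (\<Sum>i\<in>#B. grad (\<lambda>v. f v (\<zeta> i)) x)"

definition agg_grad ::
  "(real ^ 'd \<Rightarrow> 'z \<Rightarrow> real) \<Rightarrow> (nat \<Rightarrow> 'z) \<Rightarrow> nat \<Rightarrow> nat \<Rightarrow> real ^ 'd \<Rightarrow> (nat \<Rightarrow> nat multiset) \<Rightarrow> real ^ 'd"
  where
  "agg_grad f \<zeta> p b x B = (1 / (real p * real b)) *\<^sub>R (\<Sum>k\<in>{1..p}. batch_grad_sum f \<zeta> x (B k))"

text \<open>
  One realization of the run: the mini-batches \<open>I t k\<close> and the masks \<open>m t k\<close> are arbitrary
  admissible outcomes of the random choices of worker \<open>k\<close> at iteration \<open>t\<close>.
  The time index of \<open>g\<close> is an integer because the recursion starts from \<open>g (-1) k = 0\<close>.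
  The products \<open>m t k * v\<close> and the vector \<open>1\<close> are the coordinatewise ones of type \<open>vec\<close>.
\<close>

locale mdsgd =
  fixes f :: "real ^ 'd \<Rightarrow> 'z \<Rightarrow> real"
    and \<zeta> :: "nat \<Rightarrow> 'z"
    and n p b :: nat
    and \<beta> :: real
    and \<eta> :: "nat \<Rightarrow> real"
    and w0 :: "real ^ 'd"
    and I :: "nat \<Rightarrow> nat \<Rightarrow> nat multiset"
    and m :: "nat \<Rightarrow> nat \<Rightarrow> real ^ 'd"
    and w :: "nat \<Rightarrow> real ^ 'd"
    and u :: "nat \<Rightarrow> nat \<Rightarrow> real ^ 'd"
    and g :: "int \<Rightarrow> nat \<Rightarrow> real ^ 'd"
  assumes workers: "p \<ge> 1"
    and batch_size: "b \<ge> 1"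
    and momentum: "0 \<le> \<beta>" "\<beta> < 1"
    and loss_differentiable: "\<And>i x. i \<in> {1..n} \<Longrightarrow> (\<lambda>v. f v (\<zeta> i)) differentiable (at x)"
    and batches: "\<And>t k. k \<in> {1..p} \<Longrightarrow> set_mset (I t k) \<subseteq> {1..n} \<and> size (I t k) = b"
    and masks: "\<And>t k j. k \<in> {1..p} \<Longrightarrow> m t k $ j \<in> {0, 1}"
    and w_init: "w 0 = w0"
    and u_init: "\<And>k. k \<in> {1..p} \<Longrightarrow> u 0 k = 0"
    and g_init: "\<And>k. k \<in> {1..p} \<Longrightarrow> g (-1) k = 0"
    and g_step: "\<And>t k. k \<in> {1..p} \<Longrightarrow>
      g (int t) k = \<beta> *\<^sub>R g (int t - 1) k
        + (1 / (real p * real b)) *\<^sub>R batch_grad_sum f \<zeta> (w t) (I t k)"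
    and u_step: "\<And>t k. k \<in> {1..p} \<Longrightarrow> u (t + 1) k = (1 - m t k) * (g (int t) k + u t k)"
    and w_step: "\<And>t. w (t + 1) = w t - \<eta> t *\<^sub>R (\<Sum>k\<in>{1..p}. m t k * (g (int t) k + u t k))"

end

theory Submission
  imports Defs
begin

text \<open>A mask splits each worker's \<open>g + u\<close> into a part that is applied to
  \<open>w\<close> and a part kept as memory, so summed over workers the applied part is
  \<open>gt (int t) + ut t - ut (t + 1)\<close>. The memory term in \<open>z\<close> therefore
  removes the masks from the recursion, up to the drift of \<eta>, and leaves
  \<open>gt (int t)\<close> with coefficient \<rho> - \<eta>. The momentum recursion splits this
  into the fresh gradient and a multiple of \<open>gt (int t - 1)\<close>, which the condition on
  \<rho> matches with the momentum term of \<open>z t\<close>.\<close>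

theorem lemma6:
  fixes f :: "real ^ 'd \<Rightarrow> 'z \<Rightarrow> real"
    and \<zeta> :: "nat \<Rightarrow> 'z"
    and n p b :: nat
    and \<beta> :: real
    and \<eta> :: "nat \<Rightarrow> real"
    and \<rho> :: "int \<Rightarrow> real"
    and w0 :: "real ^ 'd"
    and I :: "nat \<Rightarrow> nat \<Rightarrow> nat multiset"
    and m :: "nat \<Rightarrow> nat \<Rightarrow> real ^ 'd"
    and w z ut :: "nat \<Rightarrow> real ^ 'd"
    and u :: "nat \<Rightarrow> nat \<Rightarrow> real ^ 'd"
    and g :: "int \<Rightarrow> nat \<Rightarrow> real ^ 'd"
    and gt :: "int \<Rightarrow> real ^ 'd"
  assumes run: "mdsgd f \<zeta> n p b \<beta> \<eta> w0 I m w u g"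
    and ut: "\<And>t. ut t = (\<Sum>k\<in>{1..p}. u t k)"
    and gt: "\<And>s. gt s = (\<Sum>k\<in>{1..p}. g s k)"
    and rho: "\<And>t. \<beta> * \<rho> (int t) = \<beta> * \<eta> t + \<rho> (int t - 1)"
    and z: "\<And>t. z t = w t + \<rho> (int t - 1) *\<^sub>R gt (int t - 1) - \<eta> t *\<^sub>R ut t"
  shows "(\<forall>t. gt (int t) = agg_grad f \<zeta> p b (w t) (I t) + \<beta> *\<^sub>R gt (int t - 1)) \<and>
    (\<forall>t. z (t + 1) = z t - (\<eta> t - \<rho> (int t)) *\<^sub>R agg_grad f \<zeta> p b (w t) (I t)
            + (\<eta> t - \<eta> (t + 1)) *\<^sub>R ut (t + 1))"
proof (intro conjI allI)
  interpret mdsgd f \<zeta> n p b \<beta> \<eta> w0 I m w u g by (rule run)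
  show gt_step: "gt (int t) = agg_grad f \<zeta> p b (w t) (I t) + \<beta> *\<^sub>R gt (int t - 1)" for t
    by (simp add: gt agg_grad_def g_step sum.distrib scaleR_sum_right)
  fix t
  define G where "G = agg_grad f \<zeta> p b (w t) (I t)"
  \<comment> \<open>Retained equals total minus applied, worker by worker, since the two masks sum
    to 1.\<close>
  have ut_step: "ut (t + 1) = gt (int t) + ut t - (\<Sum>k\<in>{1..p}. m t k * (g (int t) k + u t k))"
    unfolding ut gt sum.distrib[symmetric] sum_subtractf[symmetric]
    by (intro sum.cong refl) (simp only: u_step left_diff_distrib mult_1_left)
  \<comment> \<open>The index lag in \<open>z\<close> turns \<open>int (t + 1) - 1\<close> into
    \<open>int t\<close>, so \<rho> and \<open>gt\<close> enter at time \<open>t\<close>.\<close>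
  have "z (t + 1) = w t - \<eta> t *\<^sub>R (gt (int t) + ut t - ut (t + 1))
      + \<rho> (int t) *\<^sub>R gt (int t) - \<eta> (t + 1) *\<^sub>R ut (t + 1)"
    by (simp add: z w_step[simplified] ut_step[simplified])
  also have "\<dots> = w t - \<eta> t *\<^sub>R ut t - (\<eta> t - \<rho> (int t)) *\<^sub>R gt (int t)
      + (\<eta> t - \<eta> (t + 1)) *\<^sub>R ut (t + 1)"
    by (simp add: algebra_simps)
  also have "(\<eta> t - \<rho> (int t)) *\<^sub>R gt (int t)
      = (\<eta> t - \<rho> (int t)) *\<^sub>R G - \<rho> (int t - 1) *\<^sub>R gt (int t - 1)"
  proof -
    \<comment> \<open>The condition on \<rho>, rearranged without dividing by \<beta>, so \<beta> =
      0 is covered.\<close>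
    have "(\<eta> t - \<rho> (int t)) * \<beta> = - \<rho> (int t - 1)"
      using rho[of t] by (simp add: algebra_simps)
    then show ?thesis
      by (simp add: gt_step G_def scaleR_right_distrib)
  qed
  finally show "z (t + 1) = z t - (\<eta> t - \<rho> (int t)) *\<^sub>R agg_grad f \<zeta> p b (w t) (I t)
      + (\<eta> t - \<eta> (t + 1)) *\<^sub>R ut (t + 1)"
    by (simp add: z[of t] G_def)
qed

end
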